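(* The limiting number of roots $R^{[K]}$ of the ballistic deposition process on the cyclic strip $[K]$ satisfies the following. (i) $E(R^{[K]})=\frac{K}{3}$ for all $K\ge 3$. (ii) $\sigma^2(R^{[3]})=0$, $\sigma^2(R^{[4]})=\frac{2}{9}$, $\sigma^2(R^{[5]})=\frac{2}{9}$, $\sigma^2(R^{[6]})=\frac{4}{15}$, and $\sigma^2(R^{[K]})=\frac{2K}{45}$ for all $K\ge 7$. (iii) Let $\widetilde R^{[K]}=\frac{R^{[K]}-E(R^{[K]})}{\sigma(R^{[K]})}$. Then, as $K\to\infty$, $\widetilde R^{[K]}$ converges in distribution to a standard normal random variable $\mathcal N(0,1)$.
   Context: Ballistic deposition on a strip: for an integer $K\ge 3$ let $[K]=\{1,\dots,K\}$, and define the (cyclic) neighbour sets $I(1)=\{K,1,2\}$, $I(k)=\{k-1,k,k+1\}$ for $2\le k\le K-1$, and $I(K)=\{K-1,K,1\}$. Let $(X_n)_{n\ge 0}$ be i.i.d. random variables uniformly distributed on $[K]$. Define random height functions $H_n:[K]\to\{0,1,2,\dots\}$ by $H_0(k)=0$ for all $k\in[K]$ and, for $n\ge 1$, $H_n(k)=H_{n-1}(k)$ if $X_n\ne k$, and $H_n(k)=\max_{j\in I(k)}H_{n-1}(j)+1$ if $X_n=k$. The set of roots eventually formed is $\mathcal R^{[K]}=\{k\in[K]: H_i(k)=1 \text{ for some } i\ge 1\}$, and $R^{[K]}=\mathrm{Card}(\mathcal R^{[K]})$. For a random variable $X$, $E(X)$ denotes its mean, $\sigma^2(X)$ its variance, and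 $\sigma(X)=\sqrt{\sigma^2(X)}$. *)

theory Defs
  imports "HOL-Probability.Probability"
begin

definition nbrs :: "nat \<Rightarrow> nat \<Rightarrow> nat set" where
  "nbrs K k = (if k = 1 then {K, 1, 2}
               else if k = K then {K - 1, K, 1}
               else {k - 1, k, k + 1})"

text \<open>
  The heights driven by a deterministic sequence \<open>x\<close> of deposition sites; the value \<open>x 0\<close> is
  not used, the \<open>n\<close>-th deposition (\<open>n \<ge> 1\<close>) takes place at \<open>x n\<close>. Only the values at
  sites \<open>k \<in> {1..K}\<close> are meaningful.
\<close>

primrec height :: "nat \<Rightarrow> (nat \<Rightarrow> nat) \<Rightarrow> nat \<Rightarrow> nat \<Rightarrow> nat" where
  "height K x 0 = (\<lambda>k. 0)"
| "height K x (Suc n) =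
     (\<lambda>k. if x (Suc n) = k then Max (height K x n ` nbrs K k) + 1 else height K x n k)"

definition roots :: "nat \<Rightarrow> (nat \<Rightarrow> nat) \<Rightarrow> nat set" where
  "roots K x = {k \<in> {1..K}. \<exists>i\<ge>1. height K x i k = 1}"

locale ballistic_deposition = prob_space M for M :: "'a measure" +
  fixes K :: nat and X :: "nat \<Rightarrow> 'a \<Rightarrow> nat"
  assumes K_ge_3: "K \<ge> 3"
    and indep_X: "indep_vars (\<lambda>_. count_space {1..K}) X UNIV"
    and uniform_X: "\<And>n. distr M (count_space {1..K}) (X n) = uniform_count_measure {1..K}"

definition num_roots :: "nat \<Rightarrow> (nat \<Rightarrow> 'a \<Rightarrow> nat) \<Rightarrow> 'a \<Rightarrow> real" where
  "num_roots K X \<omega> = real (card (roots K (\<lambda>n. X n \<omega>)))"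

text \<open>Degenerate if the variance vanishes (division by zero yields \<open>0\<close>).\<close>

definition standardized :: "'a measure \<Rightarrow> ('a \<Rightarrow> real) \<Rightarrow> 'a \<Rightarrow> real" where
  "standardized M Y \<omega> =
     (Y \<omega> - prob_space.expectation M Y) / sqrt (prob_space.variance M Y)"

end

theory Submission
  imports Defs
begin

text \<open>
  A site becomes a root exactly if it is visited before both of its neighbours: at its first
  visit its height is then raised from \<open>0\<close> to \<open>1\<close>, whereas a neighbour visited earlier would lift it
  to at least \<open>2\<close>. Almost surely every site is visited, and because the law of the deposition
  sequence does not change when the sites are relabelled, the order of the first visits is a
  uniformly random permutation. Ranking early visits high, the number of roots is distributed
  like the number of cyclic peaks of a uniform permutation of \<open>{1..K}\<close>
  (\<open>roots_eq_first_visit_minima\<close>, \<open>sum_relabelled_roots\<close>, \<open>expectation_card_roots\<close>).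

  Peaks are counted by inserting a new maximal value into a uniformly chosen gap of the cycle.
  The new entry is a peak. If the gap is adjacent to an old peak, that peak is destroyed and the
  count does not change; otherwise it grows by one. As \<open>r\<close> peaks occupy \<open>2 * r\<close> of the \<open>K\<close> gaps, the
  count is a Markov chain that stays put with probability \<open>2 * r / K\<close> (\<open>peak_avg_Suc\<close>). Started from
  one peak at \<open>K = 3\<close>, it has mean \<open>K / 3\<close>, and its variance \<open>v\<close> obeys
  \<open>v (K + 1) = (1 - 4 / K) * v K + 2 / 9\<close>; the factor vanishes at \<open>K = 4\<close>, so that \<open>v K = 2 * K / 45\<close> from
  \<open>K = 5\<close> on.

  For the central limit theorem let \<open>R K\<close> be the count. The drift of \<open>R K - K / 3\<close> is linear, so
  \<open>(K - 1) * (K - 2) * (R K - K / 3)\<close> is a martingale. Its increments are centered Bernoulli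
  variables whose conditional variance, up to the scale, is close to its mean because \<open>R K / K\<close>
  concentrates around \<open>1 / 3\<close>. Hence one step of the chain multiplies the characteristic function
  by nearly the Gaussian factor with the same variance (\<open>mart_char_step\<close>). Multiplying these
  factors gives the Gaussian characteristic function with the exact variance; the accumulated
  error is of order \<open>1 / sqrt K\<close> after normalization (\<open>mart_char_gauss_bound\<close>), and Levy's
  continuity theorem applies.
\<close>

section \<open>Peaks of permutations of a cycle\<close>

definition is_peak :: "nat \<Rightarrow> (nat \<Rightarrow> nat) \<Rightarrow> nat \<Rightarrow> bool" where
  "is_peak K p k \<longleftrightarrow> (\<forall>j\<in>nbrs K k - {k}. p j < p k)"

definition num_peaks :: "nat \<Rightarrow> (nat \<Rightarrow> nat) \<Rightarrow> nat" where
  "num_peaks K p = card {k \<in> {1..K}. is_peak K p k}"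

definition rot :: "nat \<Rightarrow> nat \<Rightarrow> nat" where
  "rot K k = (if k \<in> {1..<K} then k + 1 else if k = K then 1 else k)"

lemma rot_permutes:
  assumes "K \<ge> 1"
  shows "rot K permutes {1..K}"
proof (rule bij_imp_permutes)
  show "bij_betw (rot K) {1..K} {1..K}"
    by (rule bij_betwI[where g = "\<lambda>k. if k = 1 then K else k - 1"])
       (use assms in \<open>auto simp: rot_def split: if_splits\<close>)
qed (use assms in \<open>auto simp: rot_def\<close>)

text \<open>
  Rotations are the symmetries of the neighbourhood structure. They serve to average over the
  position of a gap, as the site set \<open>{1..K}\<close> singles out the gap between \<open>K\<close> and \<open>1\<close>.
\<close>

lemma nbrs_rot:
  assumes "K \<ge> 3" "k \<in> {1..K}"
  shows "nbrs K (rot K k) = rot K ` nbrs K k"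
proof -
  obtain m where m: "K = Suc (Suc (Suc m))"
    using assms(1) by (metis add.commute add_Suc_right le_Suc_ex numeral_3_eq_3 plus_nat.add_0)
  consider "k = 1" | "k = K" | i where "k = Suc (Suc i)" "i \<le> m"
    using assms(2) m by (cases k; cases "k - 1") fastforce+
  then show ?thesis
    by cases (auto simp: nbrs_def rot_def m)
qed

lemma nbrs_rot_mutual:
  assumes "K \<ge> 3" "k \<in> {1..K}"
  shows "rot K k \<in> nbrs K k - {k}" "k \<in> nbrs K (rot K k) - {rot K k}"
proof -
  consider "k = 1" | "k = K" | "k \<noteq> 1" "k < K"
    using assms(2) by fastforce
  then have "rot K k \<in> nbrs K k - {k} \<and> k \<in> nbrs K (rot K k) - {rot K k}"
    using assms by cases (auto simp: nbrs_def rot_def)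
  then show "rot K k \<in> nbrs K k - {k}" "k \<in> nbrs K (rot K k) - {rot K k}"
    by blast+
qed

lemma is_peak_rot:
  assumes "K \<ge> 3" "k \<in> {1..K}"
  shows "is_peak K (p \<circ> rot K) k \<longleftrightarrow> is_peak K p (rot K k)"
proof -
  have "inj (rot K)"
    using permutes_inj[OF rot_permutes[of K]] assms(1) by simp
  then show ?thesis
    using assms by (auto simp: is_peak_def nbrs_rot inj_eq)
qed

lemma rot_power_in:
  assumes "K \<ge> 1" "k \<in> {1..K}"
  shows "(rot K ^^ j) k \<in> {1..K}"
  by (induction j) (use assms permutes_in_image[OF rot_permutes[OF assms(1)]] in auto)

lemma is_peak_rot_power:
  assumes "K \<ge> 3" "k \<in> {1..K}"
  shows "is_peak K (p \<circ> rot K ^^ j) k \<longleftrightarrow> is_peak K p ((rot K ^^ j) k)"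
  using assms(2)
proof (induction j arbitrary: k)
  case (Suc j)
  have "rot K k \<in> {1..K}"
    using rot_power_in[of K k 1] Suc.prems assms(1) by simp
  then have "is_peak K (p \<circ> rot K ^^ j \<circ> rot K) k \<longleftrightarrow> is_peak K p ((rot K ^^ j) (rot K k))"
    using Suc.IH[of "rot K k"] is_peak_rot[OF assms(1) Suc.prems, of "p \<circ> rot K ^^ j"] by (simp add: o_def)
  then show ?case
    by (simp only: funpow_Suc_right o_assoc o_apply[of _ _ k])
qed simp

lemma rot_power_permutes:
  assumes "K \<ge> 1"
  shows "(rot K ^^ j) permutes {1..K}"
proof (induction j)
  case (Suc j)
  then show ?case
    using permutes_compose[OF Suc.IH rot_permutes[OF assms]] by (simp add: o_def)
qed (simp add: permutes_id id_def[symmetric])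

lemma num_peaks_rot_power:
  assumes "K \<ge> 3"
  shows "num_peaks K (p \<circ> rot K ^^ j) = num_peaks K p"
proof -
  let ?r = "rot K ^^ j"
  have perm: "?r permutes {1..K}"
    using rot_power_permutes assms by simp
  have "bij_betw ?r {k \<in> {1..K}. is_peak K p (?r k)} {k \<in> {1..K}. is_peak K p k}"
    by (rule bij_betw_Collect[OF permutes_imp_bij[OF perm]]) simp
  then have "card {k \<in> {1..K}. is_peak K p (?r k)} = num_peaks K p"
    unfolding num_peaks_def by (rule bij_betw_same_card)
  also have "{k \<in> {1..K}. is_peak K p (?r k)} = {k \<in> {1..K}. is_peak K (p \<circ> ?r) k}"
    using is_peak_rot_power[OF assms] by blast
  finally show ?thesis
    by (simp only: num_peaks_def)
qed

text \<open>
  Starting from the last site, the powers of the rotation enumerate all sites. A sum over \<open>{1..K}\<close>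
  can thus be read as a sum over all rotations.
\<close>

lemma rot_power_K:
  assumes "j \<in> {1..K}"
  shows "(rot K ^^ j) K = j"
  using assms
proof (induction j)
  case (Suc j)
  then show ?case
    by (cases "j = 0") (auto simp: rot_def)
qed simp

text \<open>
  Composition with a rotation permutes the permutations, so any sum over them equals its average
  over all rotated copies.
\<close>

lemma sum_perms_rotations:
  fixes F :: "(nat \<Rightarrow> nat) \<Rightarrow> 'a::real_vector"
  assumes "K \<ge> 1"
  shows "(\<Sum>p | p permutes {1..K}. \<Sum>j\<in>{1..K}. F (p \<circ> rot K ^^ j)) =
           real K *\<^sub>R (\<Sum>p | p permutes {1..K}. F p)"
proof -
  have "(\<Sum>p | p permutes {1..K}. F (p \<circ> rot K ^^ j)) = (\<Sum>p | p permutes {1..K}. F p)" for j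
    using sum_permutations_compose_right[OF rot_power_permutes[OF assms], of F j] by simp
  then show ?thesis
    by (subst sum.swap) (simp add: sum_constant_scaleR)
qed

lemma adjacent_not_both_peaks:
  assumes "K \<ge> 3" "k \<in> {1..K}" "is_peak K p k"
  shows "\<not> is_peak K p (rot K k)"
proof
  assume "is_peak K p (rot K k)"
  then have "p k < p (rot K k)" "p (rot K k) < p k"
    using assms(3) nbrs_rot_mutual[OF assms(1,2)] unfolding is_peak_def by blast+
  then show False
    by simp
qed

text \<open>
  The index \<open>k\<close> stands for the gap between \<open>k\<close> and its successor. Each peak borders two gaps, and no
  gap borders two peaks because its two end points are compared with each other.
\<close>

lemma card_gaps_at_peaks:
  assumes "K \<ge> 3"
  shows "card {k \<in> {1..K}. is_peak K p k \<or> is_peak K p (rot K k)} = 2 * num_peaks K p"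
proof -
  let ?A = "{k \<in> {1..K}. is_peak K p k}" and ?B = "{k \<in> {1..K}. is_peak K p (rot K k)}"
  have "card ?B = num_peaks K p"
    using num_peaks_rot_power[OF assms, of p 1] is_peak_rot[OF assms, of _ p]
    by (simp add: num_peaks_def cong: conj_cong)
  moreover have "?A \<inter> ?B = {}"
    using adjacent_not_both_peaks[OF assms] by auto
  ultimately have "card (?A \<union> ?B) = 2 * num_peaks K p"
    using card_Un_disjoint[of ?A ?B] by (simp add: num_peaks_def)
  also have "?A \<union> ?B = {k \<in> {1..K}. is_peak K p k \<or> is_peak K p (rot K k)}"
    by blast
  finally show ?thesis .
qed

lemma num_peaks_le:
  assumes "K \<ge> 3"
  shows "2 * num_peaks K p \<le> K"
proof -
  have "card {k \<in> {1..K}. is_peak K p k \<or> is_peak K p (rot K k)} \<le> card {1..K}"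
    by (rule card_mono) (simp, blast)
  then show ?thesis
    using card_gaps_at_peaks[OF assms] by simp
qed

lemma num_peaks_pos:
  assumes "K \<ge> 3" "p permutes {1..K}"
  shows "num_peaks K p \<ge> 1"
proof -
  define k where "k = inv p K"
  have k: "k \<in> {1..K}" "p k = K"
    using permutes_in_image[OF permutes_inv[OF assms(2)], of K] permutes_inverses(1)[OF assms(2)] assms(1)
    by (auto simp: k_def)
  have "p j < p k" if "j \<in> nbrs K k - {k}" for j
  proof -
    have "j \<in> {1..K}"
      using that k assms(1) by (auto simp: nbrs_def split: if_splits)
    then have "p j \<le> K"
      using permutes_in_image[OF assms(2)] by auto
    moreover have "p j \<noteq> p k"
      using that permutes_inj[OF assms(2)] by (auto simp: inj_eq)
    ultimately show ?thesis
      using k by simp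
  qed
  then have "k \<in> {k \<in> {1..K}. is_peak K p k}"
    using k by (auto simp: is_peak_def)
  then show ?thesis
    unfolding num_peaks_def using card_gt_0_iff[of "{k \<in> {1..K}. is_peak K p k}"] by force
qed

text \<open>
  A permutation of \<open>{1..K}\<close> fixes \<open>Suc K\<close>; read on the larger cycle it has its maximum inserted in the gap
  between \<open>K\<close> and \<open>1\<close>. The maximum is a new peak, \<open>K\<close> and \<open>1\<close> cease to be peaks, and no other
  neighbourhood changes. At most one of \<open>K\<close> and \<open>1\<close> was a peak, so the count changes by one or zero.
\<close>

lemma num_peaks_Suc:
  assumes "K \<ge> 3" "p permutes {1..K}"
  shows "num_peaks (Suc K) p =
           (if is_peak K p K \<or> is_peak K p 1 then num_peaks K p else num_peaks K p + 1)"
proof -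
  have pK: "p (Suc K) = Suc K"
    using permutes_not_in[OF assms(2)] by simp
  have small: "p j \<le> K" if "j \<in> {1..K}" for j
    using permutes_in_image[OF assms(2)] that by auto
  have top: "is_peak (Suc K) p (Suc K)"
    using small[of 1] small[of K] pK assms(1) by (auto simp: is_peak_def nbrs_def)
  have ends: "\<not> is_peak (Suc K) p 1" "\<not> is_peak (Suc K) p K"
    using small[of 1] small[of K] pK assms(1) unfolding is_peak_def nbrs_def
    by (auto intro!: bexI[of _ "Suc K"])
  have inner: "is_peak (Suc K) p k \<longleftrightarrow> is_peak K p k" if "k \<in> {2..<K}" for k
    using that by (auto simp: is_peak_def nbrs_def)
  let ?I = "{k \<in> {2..<K}. is_peak K p k}"
  have "{k \<in> {1..Suc K}. is_peak (Suc K) p k} = insert (Suc K) ?I"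
  proof -
    have "k \<in> {1..Suc K} \<and> is_peak (Suc K) p k \<longleftrightarrow> k = Suc K \<or> k \<in> {2..<K} \<and> is_peak K p k" for k
      by (cases "k = 1 \<or> k = K \<or> k = Suc K") (use top ends inner[of k] in auto)
    then show ?thesis
      by blast
  qed
  then have S: "num_peaks (Suc K) p = Suc (card ?I)"
    by (simp add: num_peaks_def)
  have "rot K K = 1"
    by (auto simp: rot_def)
  then have not_both: "\<not> (is_peak K p K \<and> is_peak K p 1)"
    using adjacent_not_both_peaks[OF assms(1), of K p] assms(1) by auto
  have "{k \<in> {1..K}. is_peak K p k} =
          ?I \<union> (if is_peak K p 1 then {1} else {}) \<union> (if is_peak K p K then {K} else {})"
  proof -
    have "k \<in> {1..K} \<and> is_peak K p k \<longleftrightarrow>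
        k \<in> {2..<K} \<and> is_peak K p k \<or> k = 1 \<and> is_peak K p 1 \<or> k = K \<and> is_peak K p K" for k
      by (cases "k = 1 \<or> k = K") (use assms(1) in auto)
    then show ?thesis
      by (auto split: if_splits)
  qed
  then have "num_peaks K p = card ?I + (if is_peak K p K \<or> is_peak K p 1 then 1 else 0)"
    using not_both by (auto simp: num_peaks_def)
  then show ?thesis
    using S by auto
qed

text \<open>
  The expectation of a vector-valued function of the number of cyclic peaks of a uniform permutation.
\<close>

definition peak_avg :: "nat \<Rightarrow> (nat \<Rightarrow> 'a::real_vector) \<Rightarrow> 'a" where
  "peak_avg K f = (\<Sum>p | p permutes {1..K}. f (num_peaks K p)) /\<^sub>R fact K"

lemma permutes_fixing_last:
  "{p. p permutes {1..Suc K} \<and> p (Suc K) = Suc K} = {p. p permutes {1..K}}"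
proof -
  have "p permutes {1..K}" if "p permutes {1..Suc K}" "p (Suc K) = Suc K" for p
    by (rule permutes_superset[OF that(1)])
       (use that(2) in \<open>auto simp: atLeastAtMostSuc_conv\<close>)
  moreover have "p permutes {1..Suc K}" if "p permutes {1..K}" for p
    using permutes_subset[OF that] by auto
  ultimately show ?thesis
    using permutes_not_in[of _ "{1..K}" "Suc K"] by auto
qed

text \<open>
  By rotational symmetry the maximum may be assumed to sit at the last site; the factor counts
  its possible positions.
\<close>

lemma sum_perms_Suc:
  fixes f :: "nat \<Rightarrow> 'a::real_vector"
  assumes "K \<ge> 2"
  shows "(\<Sum>p | p permutes {1..Suc K}. f (num_peaks (Suc K) p)) =
           real (Suc K) *\<^sub>R (\<Sum>p | p permutes {1..K}. f (num_peaks (Suc K) p))"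
proof -
  let ?n = "Suc K"
  \<comment> \<open>Among the rotated copies of a permutation exactly one has its maximum at the last site.\<close>
  define F where "F p = (if p ?n = ?n then f (num_peaks ?n p) else 0)" for p
  have "(\<Sum>j\<in>{1..?n}. F (p \<circ> rot ?n ^^ j)) = f (num_peaks ?n p)" if p: "p permutes {1..?n}" for p
  proof -
    have "F (p \<circ> rot ?n ^^ j) = (if j = inv p ?n then f (num_peaks ?n p) else 0)"
      if "j \<in> {1..?n}" for j
    proof -
      have "p j = ?n \<longleftrightarrow> j = inv p ?n"
        using permutes_inverses[OF p] by metis
      then show ?thesis
        using rot_power_K[OF that] num_peaks_rot_power[of ?n p j] assms by (auto simp: F_def)
    qed
    moreover have "inv p ?n \<in> {1..?n}"
      using permutes_in_image[OF permutes_inv[OF p]] by auto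
    ultimately show ?thesis
      by (simp add: sum.delta)
  qed
  then have "(\<Sum>p | p permutes {1..?n}. f (num_peaks ?n p)) = real ?n *\<^sub>R (\<Sum>p | p permutes {1..?n}. F p)"
    using sum_perms_rotations[of ?n F] by simp
  also have "(\<Sum>p | p permutes {1..?n}. F p) = (\<Sum>p | p permutes {1..?n} \<and> p ?n = ?n. f (num_peaks ?n p))"
    unfolding F_def by (simp add: sum.inter_filter[symmetric] finite_permutations)
  finally show ?thesis
    unfolding permutes_fixing_last .
qed

text \<open>
  The transition of the insertion chain. Rotating the smaller permutation makes the gap that
  receives the new maximum uniform among all \<open>K\<close> gaps, of which twice the number of peaks are
  adjacent to a peak.
\<close>

lemma peak_avg_Suc:
  fixes f :: "nat \<Rightarrow> 'a::real_vector"
  assumes "K \<ge> 3"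
  shows "peak_avg (Suc K) f =
    peak_avg K (\<lambda>r. (2 * real r / real K) *\<^sub>R f r + (1 - 2 * real r / real K) *\<^sub>R f (Suc r))"
proof -
  \<comment> \<open>The value after insertion into the gap that follows the last site; rotating moves this gap around.\<close>
  define F where
    "F p = f (if is_peak K p K \<or> is_peak K p (rot K K) then num_peaks K p else Suc (num_peaks K p))" for p
  define G where "G r = (2 * real r / real K) *\<^sub>R f r + (1 - 2 * real r / real K) *\<^sub>R f (Suc r)" for r
  have *: "(\<Sum>j\<in>{1..K}. F (p \<circ> rot K ^^ j)) = real K *\<^sub>R G (num_peaks K p)" for p
  proof -
    let ?r = "num_peaks K p" and ?A = "{k \<in> {1..K}. is_peak K p k \<or> is_peak K p (rot K k)}"
    have "F (p \<circ> rot K ^^ j) = (if j \<in> ?A then f ?r else f (Suc ?r))" if "j \<in> {1..K}" for j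
    proof -
      have "rot K K \<in> {1..K}"
        using assms by (auto simp: rot_def)
      moreover have "(rot K ^^ j) (rot K K) = rot K j"
        using rot_power_K[OF that] by (metis funpow_swap1)
      ultimately show ?thesis
        using assms that rot_power_K[OF that]
        by (simp add: F_def num_peaks_rot_power is_peak_rot_power)
    qed
    then have "(\<Sum>j\<in>{1..K}. F (p \<circ> rot K ^^ j)) = (\<Sum>j\<in>{1..K}. if j \<in> ?A then f ?r else f (Suc ?r))"
      by (rule sum.cong[OF refl])
    also have "\<dots> = (\<Sum>j\<in>{1..K} \<inter> ?A. f ?r) + (\<Sum>j\<in>{1..K} \<inter> - ?A. f (Suc ?r))"
      by (rule sum.If_cases[OF finite_atLeastAtMost, of "\<lambda>j. j \<in> ?A", simplified Collect_mem_eq])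
    also have "{1..K} \<inter> ?A = ?A"
      by auto
    also have "{1..K} \<inter> - ?A = {1..K} - ?A"
      by auto
    also have "(\<Sum>j\<in>?A. f ?r) + (\<Sum>j\<in>{1..K} - ?A. f (Suc ?r)) =
               real (2 * ?r) *\<^sub>R f ?r + real (K - 2 * ?r) *\<^sub>R f (Suc ?r)"
      using card_gaps_at_peaks[OF assms, of p]
      by (simp only: sum_constant_scaleR) (subst card_Diff_subset, auto)
    also have "\<dots> = real K *\<^sub>R G ?r"
      using assms num_peaks_le[OF assms, of p]
      by (simp add: G_def scaleR_right_distrib of_nat_diff right_diff_distrib)
    finally show ?thesis .
  qed
  have F: "f (num_peaks (Suc K) p) = F p" if "p permutes {1..K}" for p
    using num_peaks_Suc[OF assms that] by (simp add: F_def rot_def)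
  have "real K *\<^sub>R (\<Sum>p | p permutes {1..K}. F p) = real K *\<^sub>R (\<Sum>p | p permutes {1..K}. G (num_peaks K p))"
    using sum_perms_rotations[of K F] assms by (simp only: * scaleR_sum_right)
  then have "(\<Sum>p | p permutes {1..K}. F p) = (\<Sum>p | p permutes {1..K}. G (num_peaks K p))"
    using assms by simp
  then have "(\<Sum>p | p permutes {1..Suc K}. f (num_peaks (Suc K) p)) =
      real (Suc K) *\<^sub>R (\<Sum>p | p permutes {1..K}. G (num_peaks K p))"
    using sum_perms_Suc[of K f] assms F by simp
  then show ?thesis
    unfolding peak_avg_def G_def[symmetric] by (simp add: field_simps del: of_nat_Suc)
qed

lemma peak_avg_cong:
  assumes "\<And>r. 2 * r \<le> K \<Longrightarrow> f r = g r" "K \<ge> 3"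
  shows "peak_avg K f = peak_avg K g"
  unfolding peak_avg_def using assms num_peaks_le by (auto intro!: sum.cong)

lemma peak_avg_const [simp]: "peak_avg K (\<lambda>_. c) = c"
  by (simp add: peak_avg_def card_permutations[OF refl] sum_constant_scaleR)

text \<open>
  On three sites a peak exists, namely the maximum, and two peaks do not fit.
\<close>

lemma peak_avg_3:
  "peak_avg 3 f = f 1"
proof -
  have "num_peaks 3 p = 1" if "p permutes {1..3}" for p
    using num_peaks_pos[of 3 p] num_peaks_le[of 3 p] that by simp
  then have "peak_avg 3 f = peak_avg 3 (\<lambda>_. f 1)"
    unfolding peak_avg_def by simp
  then show ?thesis
    by simp
qed

section \<open>Mean and variance of the number of peaks\<close>

lemma peak_avg_add: "peak_avg K (\<lambda>r. f r + g r) = peak_avg K f + peak_avg K g"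
  by (simp add: peak_avg_def sum.distrib scaleR_right_distrib)

lemma peak_avg_diff: "peak_avg K (\<lambda>r. f r - g r) = peak_avg K f - peak_avg K g"
  by (simp add: peak_avg_def sum_subtractf scaleR_right_diff_distrib)

lemma peak_avg_mult:
  fixes c :: "'a::real_normed_algebra"
  shows "peak_avg K (\<lambda>r. c * f r) = c * peak_avg K f"
  by (simp add: peak_avg_def sum_distrib_left[symmetric])

lemma norm_peak_avg_le:
  fixes f :: "nat \<Rightarrow> 'a::real_normed_vector"
  assumes "\<And>r. 2 * r \<le> K \<Longrightarrow> norm (f r) \<le> g r" "K \<ge> 3"
  shows "norm (peak_avg K f) \<le> peak_avg K g"
proof -
  have "norm (\<Sum>p | p permutes {1..K}. f (num_peaks K p)) \<le> (\<Sum>p | p permutes {1..K}. g (num_peaks K p))"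
    by (rule sum_norm_le) (use assms num_peaks_le in auto)
  then show ?thesis
    by (simp add: peak_avg_def divide_right_mono divide_inverse_commute)
qed

lemma peak_avg_mean:
  assumes "K \<ge> 3"
  shows "peak_avg K real = K / 3"
  using assms
proof (induction K rule: dec_induct)
  case base
  then show ?case
    by (simp add: peak_avg_3)
next
  case (step K)
  have "peak_avg (Suc K) real = peak_avg K (\<lambda>r. (1 - 2 / K) * real r + 1)"
    using step(1) by (subst peak_avg_Suc) (auto intro!: peak_avg_cong simp: field_simps)
  also have "\<dots> = (1 - 2 / K) * (K / 3) + 1"
    by (simp only: peak_avg_add peak_avg_mult peak_avg_const step.IH)
  also have "\<dots> = Suc K / 3"
    using step(1) by (simp add: field_simps)
  finally show ?case .
qed

definition peak_var :: "nat \<Rightarrow> real" where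
  "peak_var K = peak_avg K (\<lambda>r. (real r - K / 3)\<^sup>2)"

lemma peak_var_3: "peak_var 3 = 0"
  by (simp add: peak_var_def peak_avg_3)

text \<open>
  In terms of the deviation \<open>d = r - K / 3\<close>, the mean of the squared new deviation is
  \<open>(1 - 4 / K) * d^2 + 2 / 9\<close> plus a multiple of \<open>d\<close>, which averages to zero.
\<close>

lemma peak_var_Suc:
  assumes "K \<ge> 3"
  shows "peak_var (Suc K) = (1 - 4 / K) * peak_var K + 2 / 9"
proof -
  have "2 * r / K * (r - (1 + K) / 3)\<^sup>2 + (1 - 2 * r / K) * (1 + r - (1 + K) / 3)\<^sup>2 =
     (1 - 4 / K) * (r - K / 3)\<^sup>2 + (- 2 / (3 * K) * (r - K / 3) + 2 / 9)"
    for r :: real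
  proof -
    define d u where "d = r - K / 3" and "u = 1 / real K"
    \<comment> \<open>With the deviation and the reciprocal of the size as variables the claim is a polynomial identity.\<close>
    have e: "2 * r / K = 2 / 3 + 2 * d * u" "r - (1 + K) / 3 = d - 1 / 3"
        "1 + r - (1 + K) / 3 = d + 2 / 3" "4 / K = 4 * u" "- 2 / (3 * K) = - 2 / 3 * u"
      using assms by (simp_all add: d_def u_def field_simps)
    show ?thesis
      unfolding e d_def[symmetric] by (simp add: algebra_simps power2_eq_square)
  qed
  then have "peak_var (Suc K) = peak_avg K (\<lambda>r. (1 - 4 / K) * (real r - K / 3)\<^sup>2 +
      (- 2 / (3 * K) * (real r - K / 3) + 2 / 9))"
    unfolding peak_var_def using assms by (subst peak_avg_Suc) simp_all
  also have "\<dots> = (1 - 4 / K) * peak_var K + 2 / 9"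
    by (simp only: peak_avg_add peak_avg_diff peak_avg_mult peak_avg_const peak_avg_mean[OF assms]
        peak_var_def) simp
  finally show ?thesis .
qed

lemma peak_var_eq:
  assumes "K \<ge> 5"
  shows "peak_var K = 2 * K / 45"
  using assms
proof (induction K rule: dec_induct)
  case base
  then show ?case
    using peak_var_Suc[of 3] peak_var_Suc[of 4] by (simp add: peak_var_3)
next
  case (step K)
  then show ?case
    by (simp add: peak_var_Suc step.IH field_simps)
qed

lemma peak_var_4: "peak_var 4 = 2 / 9"
  using peak_var_Suc[of 3] by (simp add: peak_var_3)

lemma peak_var_nonneg: "peak_var K \<ge> 0"
  by (simp add: peak_var_def peak_avg_def sum_nonneg)

lemma peak_var_le:
  assumes "K \<ge> 3"
  shows "peak_var K \<le> 2 * (real K - 3) / 9"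
  using assms
proof (induction K rule: dec_induct)
  case base
  then show ?case
    by (simp add: peak_var_3)
next
  case (step K)
  have "(1 - 4 / K) * peak_var K \<le> 1 * peak_var K"
    by (rule mult_right_mono) (simp_all add: peak_var_nonneg)
  then have "peak_var (Suc K) \<le> peak_var K + 2 / 9"
    using peak_var_Suc[OF step(1)] by simp
  then show ?case
    using step.IH by (simp add: field_simps)
qed

text \<open>
  The mean deviation is controlled by the variance through the inequality of arithmetic and
  geometric means, applied with weight \<open>sqrt K\<close>.
\<close>

lemma peak_avg_abs_dev:
  assumes "K \<ge> 3"
  shows "peak_avg K (\<lambda>r. \<bar>real r - K / 3\<bar>) \<le> sqrt K"
proof -
  have "\<bar>y\<bar> \<le> sqrt K / 2 + 1 / (2 * sqrt K) * y\<^sup>2" for y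
  proof -
    have "0 \<le> (\<bar>y\<bar> - sqrt K)\<^sup>2"
      by simp
    then have "2 * \<bar>y\<bar> * sqrt K \<le> y\<^sup>2 + K"
      by (simp add: power2_diff)
    then show ?thesis
      using assms by (simp add: field_simps)
  qed
  then have "norm (peak_avg K (\<lambda>r. \<bar>real r - K / 3\<bar>)) \<le>
      peak_avg K (\<lambda>r. sqrt K / 2 + 1 / (2 * sqrt K) * (real r - K / 3)\<^sup>2)"
    by (intro norm_peak_avg_le assms) simp
  also have "\<dots> = sqrt K / 2 + 1 / (2 * sqrt K) * peak_var K"
    by (simp only: peak_avg_add peak_avg_mult peak_avg_const peak_var_def)
  also have "\<dots> \<le> sqrt K / 2 + 1 / (2 * sqrt K) * K"
    using peak_var_le[OF assms] by (intro add_left_mono mult_left_mono) simp_all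
  also have "\<dots> = sqrt K"
    using assms by (simp add: field_simps)
  finally show ?thesis
    by simp
qed

section \<open>Gaussian limit of the number of peaks\<close>

text \<open>
  The left-hand side compares the characteristic function of a centered Bernoulli variable with its
  second-order Taylor polynomial; the first-order terms cancel as the variable has mean zero.
\<close>

lemma centered_bernoulli_char_approx:
  fixes p \<theta> :: real
  assumes "0 \<le> p" "p \<le> 1"
  shows "cmod (p * iexp (\<theta> * (1 - p)) + (1 - p) * iexp (- (\<theta> * p)) - (1 - \<theta>\<^sup>2 * (p * (1 - p)) / 2)) \<le> \<bar>\<theta>\<bar> ^ 3"
proof -
  define e where "e x = iexp x - (1 + \<i> * x - x\<^sup>2 / 2)" for x :: real
  have e: "cmod (e x) \<le> \<bar>x\<bar> ^ 3" for x
  proof -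
    have "cmod (e x) \<le> \<bar>x\<bar> ^ 3 / 6"
      using iexp_approx1[of x 2] by (simp add: e_def eval_nat_numeral power_mult_distrib algebra_simps)
    then show ?thesis
      by (rule order_trans) simp
  qed
  have small: "cmod (e x) \<le> \<bar>\<theta>\<bar> ^ 3" if "\<bar>x\<bar> \<le> \<bar>\<theta>\<bar>" for x
    using order_trans[OF e power_mono[OF that, of 3]] by simp
  have "p * iexp (\<theta> * (1 - p)) + (1 - p) * iexp (- (\<theta> * p)) - (1 - \<theta>\<^sup>2 * (p * (1 - p)) / 2) =
        p * e (\<theta> * (1 - p)) + (1 - p) * e (- (\<theta> * p))"
    by (simp add: e_def field_simps power2_eq_square)
  also have "cmod \<dots> \<le> p * cmod (e (\<theta> * (1 - p))) + (1 - p) * cmod (e (- (\<theta> * p)))"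
    using assms by (intro norm_triangle_le) (simp add: norm_mult del: of_real_diff)
  also have "\<dots> \<le> p * \<bar>\<theta>\<bar> ^ 3 + (1 - p) * \<bar>\<theta>\<bar> ^ 3"
    using assms by (intro add_mono mult_left_mono small) (auto simp: abs_mult intro!: mult_left_le)
  finally show ?thesis
    by (simp add: algebra_simps)
qed

lemma exp_minus_approx:
  fixes x :: real
  assumes "x \<ge> 0"
  shows "\<bar>1 - x - exp (- x)\<bar> \<le> x\<^sup>2"
proof -
  have "exp (- x) * (1 + x) \<le> exp (- x) * exp x"
    by (intro mult_left_mono exp_ge_add_one_self) simp
  then have "exp (- x) \<le> 1 / (1 + x)"
    using assms by (simp add: exp_minus field_simps)
  also have "\<dots> \<le> 1 - x + x\<^sup>2"
    using assms by (simp add: field_simps power2_eq_square)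
  finally show ?thesis
    using exp_ge_add_one_self[of "- x"] by (simp add: abs_le_iff)
qed

text \<open>
  The normalization that turns the centered peak count into a martingale: the drift factor
  \<open>1 - 2 / n\<close> equals \<open>mart_scale n / mart_scale (Suc n)\<close>.
\<close>

definition mart_scale :: "nat \<Rightarrow> real" where
  "mart_scale n = (real n - 1) * (real n - 2)"

definition mart_char :: "real \<Rightarrow> nat \<Rightarrow> complex" where
  "mart_char s n = peak_avg n (\<lambda>r. iexp (s * (mart_scale n * (real r - n / 3))))"

text \<open>
  The mean of \<open>p * (1 - p)\<close> over the random growth probability \<open>p = 1 - 2 * r / n\<close>: the mean of \<open>p\<close> is
  \<open>1 / 3\<close> and its variance is \<open>4 * peak_var n / n^2\<close>.
\<close>

definition step_var :: "nat \<Rightarrow> real" where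
  "step_var n = 2 / 9 - 4 * peak_var n / n\<^sup>2"

text \<open>
  Given \<open>r\<close> peaks, the martingale increment is \<open>mart_scale (Suc n) * (b - p r)\<close> with \<open>b\<close> a Bernoulli
  variable of parameter \<open>p r\<close>, so one step inserts its characteristic function under the average.
\<close>

lemma mart_char_Suc:
  assumes "n \<ge> 3"
  defines "\<theta> \<equiv> \<lambda>s. s * mart_scale (Suc n)"
    and "p \<equiv> \<lambda>r. 1 - 2 * real r / n"
  shows "mart_char s (Suc n) = peak_avg n (\<lambda>r. iexp (s * (mart_scale n * (real r - n / 3))) *
           (p r * iexp (\<theta> s * (1 - p r)) + (1 - p r) * iexp (- (\<theta> s * p r))))"
proof -
  have "(2 * r / n) *\<^sub>R iexp (s * (mart_scale (Suc n) * (r - Suc n / 3))) +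
          (1 - 2 * r / n) *\<^sub>R iexp (s * (mart_scale (Suc n) * (Suc r - Suc n / 3))) =
        iexp (s * (mart_scale n * (r - n / 3))) *
          (p r * iexp (\<theta> s * (1 - p r)) + (1 - p r) * iexp (- (\<theta> s * p r)))" for r :: nat
  proof -
    have "mart_scale (Suc n) * (r - Suc n / 3) = mart_scale n * (r - n / 3) - mart_scale (Suc n) * p r"
      using assms(1) by (simp add: mart_scale_def p_def field_simps)
    note shift = this
    have a: "s * (mart_scale (Suc n) * (r - Suc n / 3)) = s * (mart_scale n * (r - n / 3)) + - (\<theta> s * p r)"
      unfolding shift by (simp add: \<theta>_def algebra_simps)
    have "s * (mart_scale (Suc n) * (Suc r - Suc n / 3)) = s * (mart_scale (Suc n) * (r - Suc n / 3)) + \<theta> s"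
      by (simp add: \<theta>_def algebra_simps)
    then have b: "s * (mart_scale (Suc n) * (Suc r - Suc n / 3)) = s * (mart_scale n * (r - n / 3)) + \<theta> s * (1 - p r)"
      unfolding a by (simp add: algebra_simps)
    have iexp_add: "iexp (x + y) = iexp x * iexp y" for x y
      by (simp add: exp_add ring_distribs)
    have c: "2 * r / n = 1 - p r"
      by (simp add: p_def)
    show ?thesis
      unfolding a b c iexp_add by (simp add: algebra_simps scaleR_conv_of_real)
  qed
  then show ?thesis
    unfolding mart_char_def using assms(1) by (subst peak_avg_Suc) simp_all
qed

lemma step_var_bounds:
  assumes "n \<ge> 3"
  shows "0 \<le> step_var n" "step_var n \<le> 2 / 9" "\<bar>2 / 9 - step_var n\<bar> \<le> 8 / (9 * real n)"
proof -
  have v: "4 * peak_var n / n\<^sup>2 \<le> 8 / (9 * real n)"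
  proof -
    have "9 * peak_var n \<le> 2 * n"
      using peak_var_le[OF assms] by simp
    then show ?thesis
      using assms by (simp add: field_simps power2_eq_square)
  qed
  have v': "4 * peak_var n / n\<^sup>2 \<le> 2 / 9"
  proof -
    have "0 \<le> (real n - 2)\<^sup>2"
      by simp
    then have "4 * (real n - 3) \<le> (real n)\<^sup>2"
      by (simp add: power2_eq_square algebra_simps)
    then have "4 * peak_var n * 9 \<le> 2 * n\<^sup>2"
      using peak_var_le[OF assms] by simp
    then show ?thesis
      using assms by (simp add: field_simps)
  qed
  show "0 \<le> step_var n" "step_var n \<le> 2 / 9" "\<bar>2 / 9 - step_var n\<bar> \<le> 8 / (9 * real n)"
    using v v' peak_var_nonneg[of n] by (simp_all add: step_var_def)
qed

text \<open>
  Three errors are made when the increment's characteristic function is replaced by the Gaussian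
  factor: the Taylor remainder (cubic in \<open>\<theta>\<close>), the replacement of the conditional variance by its
  mean (small on average, by the bound on the mean deviation of the count), and the replacement of
  \<open>1 - x\<close> by \<open>exp (- x)\<close> (quartic in \<open>\<theta>\<close>).
\<close>

lemma mart_char_step:
  assumes "n \<ge> 3"
  defines "\<theta> \<equiv> \<lambda>s. s * mart_scale (Suc n)"
  shows "cmod (mart_char s (Suc n) - exp (- ((\<theta> s)\<^sup>2 * step_var n / 2)) * mart_char s n) \<le>
           \<bar>\<theta> s\<bar> ^ 3 + \<bar>\<theta> s\<bar> ^ 4 + 2 * (\<theta> s)\<^sup>2 / sqrt n"
proof -
  define w \<tau> where "w = step_var n" and "\<tau> = \<theta> s"
  define x where "x = \<tau>\<^sup>2 * w / 2"
  define Z p y where "Z r = s * (mart_scale n * (real r - n / 3))" and "p r = 1 - 2 * real r / n"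
    and "y r = real r - n / 3" for r
  define B where "B r = p r * iexp (\<tau> * (1 - p r)) + (1 - p r) * iexp (- (\<tau> * p r))" for r
  define g where "g r = (\<bar>\<tau>\<bar> ^ 3 + \<bar>\<tau>\<bar> ^ 4 + 4 * \<tau>\<^sup>2 / (9 * n)) + 2 * \<tau>\<^sup>2 / (3 * n) * \<bar>y r\<bar>" for r
  have w: "0 \<le> w" "w \<le> 2 / 9" "\<bar>2 / 9 - w\<bar> \<le> 8 / (9 * real n)"
    using step_var_bounds[OF assms(1)] by (simp_all add: w_def)
  have x: "0 \<le> x" "x\<^sup>2 \<le> \<bar>\<tau>\<bar> ^ 4"
  proof -
    show "0 \<le> x"
      using w by (simp add: x_def)
    have "x \<le> \<tau>\<^sup>2"
      using w mult_left_mono[of w 2 "\<tau>\<^sup>2"] by (simp add: x_def)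
    then have "x\<^sup>2 \<le> (\<tau>\<^sup>2)\<^sup>2"
      using \<open>0 \<le> x\<close> by (rule power_mono)
    then show "x\<^sup>2 \<le> \<bar>\<tau>\<bar> ^ 4"
      by simp
  qed
  have pointwise: "cmod (iexp (Z r) * (B r - exp (- x))) \<le> g r" if r: "2 * r \<le> n" for r
  proof -
    have p: "0 \<le> p r" "p r \<le> 1"
      using r assms(1) by (simp_all add: p_def field_simps)
    \<comment> \<open>The function vanishes at the mean value 1/3 of the growth probability and is Lipschitz with constant 2/3.\<close>
    have "p r * (1 - p r) - 2 / 9 = - (2 * y r / n) * (2 / 3 - p r)"
      using assms(1) by (simp add: p_def y_def field_simps power2_eq_square)
    then have "\<bar>p r * (1 - p r) - 2 / 9\<bar> = 2 * \<bar>y r\<bar> / n * \<bar>2 / 3 - p r\<bar>"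
      by (simp add: abs_mult)
    also have "\<dots> \<le> 2 * \<bar>y r\<bar> / n * (2 / 3)"
    proof (rule mult_left_mono)
      show "\<bar>2 / 3 - p r\<bar> \<le> 2 / 3"
        using p by linarith
    qed simp
    finally have "\<bar>w - p r * (1 - p r)\<bar> \<le> 4 * \<bar>y r\<bar> / (3 * n) + 8 / (9 * n)"
      using w(3) by (simp add: abs_le_iff)
    then have "\<tau>\<^sup>2 / 2 * \<bar>w - p r * (1 - p r)\<bar> \<le> \<tau>\<^sup>2 / 2 * (4 * \<bar>y r\<bar> / (3 * n) + 8 / (9 * n))"
      by (intro mult_left_mono) simp_all
    also have "\<dots> = 2 * \<tau>\<^sup>2 / (3 * n) * \<bar>y r\<bar> + 4 * \<tau>\<^sup>2 / (9 * n)"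
      by (simp add: algebra_simps)
    finally have "\<tau>\<^sup>2 / 2 * \<bar>w - p r * (1 - p r)\<bar> \<le> 2 * \<tau>\<^sup>2 / (3 * n) * \<bar>y r\<bar> + 4 * \<tau>\<^sup>2 / (9 * n)" .
    moreover define q where "q = 1 - \<tau>\<^sup>2 * (p r * (1 - p r)) / 2"
    moreover have "\<bar>q - (1 - x)\<bar> = \<tau>\<^sup>2 / 2 * \<bar>w - p r * (1 - p r)\<bar>"
    proof -
      have "q - (1 - x) = \<tau>\<^sup>2 / 2 * (w - p r * (1 - p r))"
        by (simp add: q_def x_def field_simps)
      then show ?thesis
        by (simp only: abs_mult) simp
    qed
    moreover have "\<bar>q - exp (- x)\<bar> \<le> \<bar>q - (1 - x)\<bar> + \<bar>1 - x - exp (- x)\<bar>"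
      using abs_triangle_ineq[of "q - (1 - x)" "1 - x - exp (- x)"] by simp
    ultimately have "\<bar>q - exp (- x)\<bar> \<le> 2 * \<tau>\<^sup>2 / (3 * n) * \<bar>y r\<bar> + 4 * \<tau>\<^sup>2 / (9 * n) + \<bar>\<tau>\<bar> ^ 4"
      using exp_minus_approx[OF x(1)] x(2) by linarith
    then have "cmod (complex_of_real (q - exp (- x))) \<le>
        2 * \<tau>\<^sup>2 / (3 * n) * \<bar>y r\<bar> + 4 * \<tau>\<^sup>2 / (9 * n) + \<bar>\<tau>\<bar> ^ 4"
      by (simp only: norm_of_real)
    moreover have "cmod (B r - q) \<le> \<bar>\<tau>\<bar> ^ 3"
      using centered_bernoulli_char_approx[OF p, of \<tau>] by (simp add: B_def q_def)
    ultimately have "cmod (B r - exp (- x)) \<le> g r"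
      using norm_triangle_ineq[of "B r - q" "complex_of_real (q - exp (- x))"]
      by (simp add: g_def)
    then show ?thesis
      by (simp add: norm_mult)
  qed
  have "mart_char s (Suc n) - exp (- x) * mart_char s n = peak_avg n (\<lambda>r. iexp (Z r) * (B r - exp (- x)))"
    unfolding mart_char_Suc[OF assms(1)]
    unfolding mart_char_def peak_avg_mult[symmetric] peak_avg_diff[symmetric] Z_def B_def p_def \<tau>_def \<theta>_def
    by (simp add: right_diff_distrib mult.commute)
  then have "cmod (mart_char s (Suc n) - exp (- x) * mart_char s n) \<le> peak_avg n g"
    using norm_peak_avg_le[OF pointwise assms(1)] by simp
  also have "peak_avg n g = (\<bar>\<tau>\<bar> ^ 3 + \<bar>\<tau>\<bar> ^ 4 + 4 * \<tau>\<^sup>2 / (9 * n)) +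
      2 * \<tau>\<^sup>2 / (3 * n) * peak_avg n (\<lambda>r. \<bar>y r\<bar>)"
    unfolding g_def by (simp only: peak_avg_add peak_avg_mult peak_avg_const)
  also have "\<dots> \<le> (\<bar>\<tau>\<bar> ^ 3 + \<bar>\<tau>\<bar> ^ 4 + 4 * \<tau>\<^sup>2 / (9 * n)) + 2 * \<tau>\<^sup>2 / (3 * n) * sqrt n"
    using peak_avg_abs_dev[OF assms(1)] by (intro add_left_mono mult_left_mono) (simp_all add: y_def)
  also have "\<dots> \<le> \<bar>\<tau>\<bar> ^ 3 + \<bar>\<tau>\<bar> ^ 4 + 2 * \<tau>\<^sup>2 / sqrt n"
  proof -
    have "sqrt n \<le> sqrt n * sqrt n"
      using assms(1) mult_left_mono[of 1 "sqrt n" "sqrt n"] by simp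
    then have "1 / n \<le> 1 / sqrt n"
      using assms(1) by (intro divide_left_mono) auto
    then have "\<tau>\<^sup>2 * (1 / n) \<le> \<tau>\<^sup>2 * (1 / sqrt n)"
      by (intro mult_left_mono) simp_all
    moreover have "2 * \<tau>\<^sup>2 / (3 * n) * sqrt n = 2 / 3 * (\<tau>\<^sup>2 * (1 / sqrt n))"
      using assms(1) by (simp add: field_simps)
    moreover have "4 * \<tau>\<^sup>2 / (9 * n) = 4 / 9 * (\<tau>\<^sup>2 * (1 / n))"
        "2 * \<tau>\<^sup>2 / sqrt n = 2 * (\<tau>\<^sup>2 * (1 / sqrt n))"
      by simp_all
    moreover have "0 \<le> \<tau>\<^sup>2 * (1 / sqrt n)"
      by simp
    ultimately show ?thesis
      by linarith
  qed
  finally show ?thesis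
    by (simp add: x_def w_def \<tau>_def)
qed

lemma mart_scale_mono:
  assumes "3 \<le> m" "m \<le> n"
  shows "0 \<le> mart_scale m" "mart_scale m \<le> mart_scale n"
  using assms by (auto simp: mart_scale_def intro!: mult_mono)

text \<open>
  Martingale increments are uncorrelated, so their variances add up. This makes the product of the
  Gaussian factors telescope to the Gaussian with the exact variance.
\<close>

lemma mart_scale_var_Suc:
  assumes "n \<ge> 3"
  shows "(mart_scale (Suc n))\<^sup>2 * peak_var (Suc n) =
         (mart_scale n)\<^sup>2 * peak_var n + (mart_scale (Suc n))\<^sup>2 * step_var n"
  using assms by (simp add: mart_scale_def step_var_def peak_var_Suc field_simps power2_eq_square)

text \<open>
  The Gaussian factors have modulus at most one, so the errors of the single steps add up. They are
  all measured at the largest scale \<open>N\<close>, since the scale increases with the number of sites.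
\<close>

lemma mart_char_gauss_bound:
  assumes "3 \<le> m" "m \<le> N"
  defines "\<tau> \<equiv> \<lambda>s. \<bar>s\<bar> * mart_scale N"
  shows "cmod (mart_char s m - exp (- (s\<^sup>2 * ((mart_scale m)\<^sup>2 * peak_var m) / 2))) \<le>
           m * (\<tau> s ^ 3 + \<tau> s ^ 4) + 6 * (\<tau> s)\<^sup>2 * sqrt m"
  using assms(1,2)
proof (induction m rule: dec_induct)
  case base
  have "0 \<le> \<tau> s"
    using mart_scale_mono[of 3 N] base by (simp add: \<tau>_def)
  then show ?case
    by (simp add: mart_char_def peak_avg_3 peak_var_3)
next
  case (step n)
  define G where "G m = complex_of_real (exp (- (s\<^sup>2 * ((mart_scale m)\<^sup>2 * peak_var m) / 2)))" for m
  define \<theta> where "\<theta> = s * mart_scale (Suc n)"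
  define E where "E = exp (- (\<theta>\<^sup>2 * step_var n / 2))"
  have \<theta>: "\<bar>\<theta>\<bar> \<le> \<tau> s" "0 \<le> \<tau> s"
    using mart_scale_mono[of "Suc n" N] step by (auto simp: \<theta>_def \<tau>_def abs_mult intro!: mult_left_mono)
  have "s\<^sup>2 * ((mart_scale (Suc n))\<^sup>2 * peak_var (Suc n)) / 2 =
      \<theta>\<^sup>2 * step_var n / 2 + s\<^sup>2 * ((mart_scale n)\<^sup>2 * peak_var n) / 2"
    unfolding mart_scale_var_Suc[OF step(1)] by (simp add: \<theta>_def power_mult_distrib algebra_simps)
  then have "G (Suc n) = E * G n"
    by (simp only: G_def E_def minus_add_distrib exp_add of_real_mult)
  then have "mart_char s (Suc n) - G (Suc n) = (mart_char s (Suc n) - E * mart_char s n) + E * (mart_char s n - G n)"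
    by (simp add: algebra_simps)
  also have "cmod \<dots> \<le> cmod (mart_char s (Suc n) - E * mart_char s n) + E * cmod (mart_char s n - G n)"
    by (intro norm_triangle_le) (simp add: norm_mult E_def)
  also have "\<dots> \<le> (\<tau> s ^ 3 + \<tau> s ^ 4 + 2 * (\<tau> s)\<^sup>2 / sqrt n) + (n * (\<tau> s ^ 3 + \<tau> s ^ 4) + 6 * (\<tau> s)\<^sup>2 * sqrt n)"
  proof (rule add_mono)
    have "cmod (mart_char s (Suc n) - E * mart_char s n) \<le> \<bar>\<theta>\<bar> ^ 3 + \<bar>\<theta>\<bar> ^ 4 + 2 * \<bar>\<theta>\<bar>\<^sup>2 / sqrt n"
      using mart_char_step[OF step(1), of s] by (simp add: E_def \<theta>_def)
    also have "\<dots> \<le> \<tau> s ^ 3 + \<tau> s ^ 4 + 2 * (\<tau> s)\<^sup>2 / sqrt n"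
      using \<theta> by (intro add_mono power_mono divide_right_mono mult_left_mono) simp_all
    finally show "cmod (mart_char s (Suc n) - E * mart_char s n) \<le> \<tau> s ^ 3 + \<tau> s ^ 4 + 2 * (\<tau> s)\<^sup>2 / sqrt n" .
    have "E * cmod (mart_char s n - G n) \<le> 1 * cmod (mart_char s n - G n)"
    proof (intro mult_right_mono)
      have "0 \<le> step_var n"
        using step_var_bounds step(1) by simp
      then show "E \<le> 1"
        by (simp add: E_def)
    qed simp
    also have "\<dots> \<le> n * (\<tau> s ^ 3 + \<tau> s ^ 4) + 6 * (\<tau> s)\<^sup>2 * sqrt n"
      using step.IH step.prems step.hyps by (simp add: G_def)
    finally show "E * cmod (mart_char s n - G n) \<le> n * (\<tau> s ^ 3 + \<tau> s ^ 4) + 6 * (\<tau> s)\<^sup>2 * sqrt n" .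
  qed
  also have "\<dots> \<le> Suc n * (\<tau> s ^ 3 + \<tau> s ^ 4) + 6 * (\<tau> s)\<^sup>2 * sqrt (Suc n)"
  proof -
    \<comment> \<open>The constant 6 makes the increment of the square root pay for the error of one step.\<close>
    have "1 / (3 * sqrt n) + sqrt n \<le> sqrt (Suc n)"
    proof (rule real_le_rsqrt)
      have "(1 / (3 * sqrt n) + sqrt n)\<^sup>2 = 1 / (9 * n) + 2 / 3 + n"
        using step(1) by (simp add: power2_sum power_divide power_mult_distrib)
      also have "\<dots> \<le> Suc n"
        using step(1) by (simp add: field_simps)
      finally show "(1 / (3 * sqrt n) + sqrt n)\<^sup>2 \<le> Suc n" .
    qed
    then have "6 * (\<tau> s)\<^sup>2 * (1 / (3 * sqrt n) + sqrt n) \<le> 6 * (\<tau> s)\<^sup>2 * sqrt (Suc n)"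
      by (intro mult_left_mono) simp_all
    then show ?thesis
      by (simp add: algebra_simps)
  qed
  finally show ?case
    by (simp add: G_def)
qed

text \<open>
  The bound is used at \<open>s = t / (mart_scale N * sqrt (peak_var N))\<close>. There \<open>\<tau> s\<close> is a constant multiple
  of \<open>1 / sqrt N\<close>, and the error bound tends to zero.
\<close>

lemma peak_avg_gauss_limit:
  "(\<lambda>N. peak_avg N (\<lambda>r. iexp (t * ((real r - N / 3) / sqrt (peak_var N))))) \<longlonglongrightarrow>
     complex_of_real (exp (- (t\<^sup>2 / 2)))"
proof -
  define c where "c = \<bar>t\<bar> * sqrt (45 / 2)"
  define b where "b N = N * ((c / sqrt N) ^ 3 + (c / sqrt N) ^ 4) + 6 * (c / sqrt N)\<^sup>2 * sqrt N" for N :: nat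
  have "cmod (peak_avg N (\<lambda>r. iexp (t * ((real r - N / 3) / sqrt (peak_var N)))) - exp (- (t\<^sup>2 / 2))) \<le> b N"
    if "N \<ge> 5" for N
  proof -
    define s where "s = t / (mart_scale N * sqrt (peak_var N))"
    have pos: "mart_scale N > 0" "peak_var N > 0"
      using that by (simp_all add: mart_scale_def peak_var_eq)
    have "\<bar>s\<bar> * mart_scale N = c / sqrt N"
    proof -
      have "\<bar>s\<bar> * mart_scale N = \<bar>t\<bar> / sqrt (peak_var N)"
        using pos by (simp add: s_def abs_mult)
      also have "sqrt (peak_var N) = sqrt N / sqrt (45 / 2)"
        using that by (simp add: peak_var_eq real_sqrt_divide[symmetric])
      finally show ?thesis
        by (simp add: c_def)
    qed
    moreover have "s * (mart_scale N * (real r - N / 3)) = t * ((real r - N / 3) / sqrt (peak_var N))" for r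
      using pos by (simp add: s_def)
    moreover have "s\<^sup>2 * ((mart_scale N)\<^sup>2 * peak_var N) = t\<^sup>2"
      using pos by (simp add: s_def power_divide power_mult_distrib)
    ultimately show ?thesis
      using mart_char_gauss_bound[of N N s] that by (simp add: mart_char_def b_def)
  qed
  then have "eventually (\<lambda>N. norm (peak_avg N (\<lambda>r. iexp (t * ((real r - N / 3) / sqrt (peak_var N)))) -
      exp (- (t\<^sup>2 / 2))) \<le> b N) sequentially"
    by (auto simp: eventually_at_top_linorder)
  moreover have "b \<longlonglongrightarrow> 0"
  proof -
    define u where "u N = 1 / sqrt (real N)" for N :: nat
    have u: "u \<longlonglongrightarrow> 0"
      unfolding u_def by (intro tendsto_divide_0[OF tendsto_const] filterlim_at_top_imp_at_infinity
          filterlim_compose[OF sqrt_at_top] filterlim_real_sequentially)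
    have "(\<lambda>N. c ^ 3 * u N + c ^ 4 * (u N)\<^sup>2 + 6 * c\<^sup>2 * u N) \<longlonglongrightarrow> c ^ 3 * 0 + c ^ 4 * 0\<^sup>2 + 6 * c\<^sup>2 * 0"
      by (intro tendsto_intros u)
    moreover have "c ^ 3 * u N + c ^ 4 * (u N)\<^sup>2 + 6 * c\<^sup>2 * u N = b N" if "N \<ge> 1" for N
      using that by (simp add: b_def u_def field_simps eval_nat_numeral)
    ultimately show ?thesis
      by (auto elim!: Lim_transform_eventually intro!: eventually_sequentiallyI[of 1])
  qed
  ultimately show ?thesis
    by (rule LIM_zero_cancel[OF Lim_null_comparison])
qed

section \<open>Roots as local minima of the first visit times\<close>

lemma self_in_nbrs: "k \<in> nbrs K k"
  by (simp add: nbrs_def)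

lemma finite_nbrs: "finite (nbrs K k)"
  by (simp add: nbrs_def)

lemma nbrs_subset:
  assumes "K \<ge> 3" "k \<in> {1..K}"
  shows "nbrs K k \<subseteq> {1..K}"
  using assms by (auto simp: nbrs_def)

lemma height_eq_0_iff: "height K x n k = 0 \<longleftrightarrow> k \<notin> x ` {1..n}"
  by (induction n) (auto simp: atLeastAtMostSuc_conv)

lemma height_mono:
  assumes "m \<le> n"
  shows "height K x m k \<le> height K x n k"
  using assms
proof (induction n rule: dec_induct)
  case (step n)
  have "height K x n k \<le> Max (height K x n ` nbrs K k)"
    by (intro Max_ge) (auto simp: finite_nbrs self_in_nbrs)
  then show ?case
    using step.IH by auto
qed simp

text \<open>
  Heights never decrease, and a site has height zero until its first visit. The height reached at
  that first visit therefore decides whether the value one is ever attained.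
\<close>

lemma root_iff_first_among_nbrs:
  assumes "x (Suc m) = k" "k \<notin> x ` {1..m}"
  shows "(\<exists>i\<ge>1. height K x i k = 1) \<longleftrightarrow> (\<forall>j\<in>nbrs K k. j \<notin> x ` {1..m})"
proof
  assume free: "\<forall>j\<in>nbrs K k. j \<notin> x ` {1..m}"
  have "height K x m j = 0" if "j \<in> nbrs K k" for j
    unfolding height_eq_0_iff using free that by blast
  then have "height K x m ` nbrs K k = (\<lambda>_. 0) ` nbrs K k"
    by (rule image_cong[OF refl])
  also have "\<dots> = {0}"
    using self_in_nbrs[of k K] by blast
  finally have "height K x (Suc m) k = 1"
    using assms(1) by simp
  then show "\<exists>i\<ge>1. height K x i k = 1"
    by (intro exI[of _ "Suc m"]) simp
next
  assume "\<exists>i\<ge>1. height K x i k = 1"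
  then obtain i where i: "height K x i k = 1"
    by blast
  show "\<forall>j\<in>nbrs K k. j \<notin> x ` {1..m}"
  proof (rule ccontr)
    assume "\<not> ?thesis"
    then obtain j where j: "j \<in> nbrs K k" "height K x m j \<noteq> 0"
      unfolding height_eq_0_iff by blast
    have "height K x m j \<le> Max (height K x m ` nbrs K k)"
      using j(1) by (intro Max_ge finite_imageI finite_nbrs imageI)
    then have late: "height K x (Suc m) k \<ge> 2"
      using assms(1) j(2) by simp
    have early: "height K x m k = 0"
      unfolding height_eq_0_iff by (rule assms(2))
    show False
    proof (cases "i \<le> m")
      case True
      then show ?thesis
        using height_mono[OF True, of K x k] i early by simp
    next
      case False
      then show ?thesis
        using height_mono[of "Suc m" i K x k] i late by simp
    qed
  qed
qed

text \<open>
  Time \<open>0\<close> is excluded because the first deposition happens at time \<open>1\<close>.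
\<close>

definition first_visit :: "(nat \<Rightarrow> nat) \<Rightarrow> nat \<Rightarrow> nat" where
  "first_visit x k = (LEAST n. 1 \<le> n \<and> x n = k)"

lemma first_visit:
  assumes "\<exists>n\<ge>1. x n = k"
  shows "1 \<le> first_visit x k" "x (first_visit x k) = k"
proof -
  obtain n where "1 \<le> n \<and> x n = k"
    using assms by blast
  then have "1 \<le> first_visit x k \<and> x (first_visit x k) = k"
    unfolding first_visit_def by (rule LeastI)
  then show "1 \<le> first_visit x k" "x (first_visit x k) = k"
    by simp_all
qed

lemma first_visit_le:
  assumes "1 \<le> n" "x n = k"
  shows "first_visit x k \<le> n"
  unfolding first_visit_def using assms by (intro Least_le) simp

lemma roots_eq_first_visit_minima:
  assumes "K \<ge> 3" and visited: "\<And>k. k \<in> {1..K} \<Longrightarrow> \<exists>n\<ge>1. x n = k"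
  shows "roots K x = {k \<in> {1..K}. \<forall>j\<in>nbrs K k - {k}. first_visit x k < first_visit x j}"
proof -
  have "(\<exists>i\<ge>1. height K x i k = 1) \<longleftrightarrow> (\<forall>j\<in>nbrs K k - {k}. first_visit x k < first_visit x j)"
    if k: "k \<in> {1..K}" for k
  proof -
    obtain m where m: "first_visit x k = Suc m"
      using first_visit(1)[OF visited[OF k]] by (cases "first_visit x k") simp_all
    have before: "j \<notin> x ` {1..m} \<longleftrightarrow> Suc m \<le> first_visit x j" if j: "j \<in> {1..K}" for j
    proof -
      have "1 \<le> first_visit x j" "x (first_visit x j) = j"
        using first_visit[OF visited[OF j]] by simp_all
      moreover have "first_visit x j \<le> m" if n: "n \<in> {1..m}" "j = x n" for n
        using first_visit_le[of n x j] n by simp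
      ultimately have "j \<in> x ` {1..m} \<longleftrightarrow> first_visit x j \<le> m"
        by (metis atLeastAtMost_iff imageE imageI)
      then show ?thesis
        by auto
    qed
    have "x (Suc m) = k"
      using first_visit(2)[OF visited[OF k]] m by simp
    moreover have "k \<notin> x ` {1..m}"
      using before[OF k] m by simp
    ultimately have "(\<exists>i\<ge>1. height K x i k = 1) \<longleftrightarrow> (\<forall>j\<in>nbrs K k. j \<notin> x ` {1..m})"
      by (rule root_iff_first_among_nbrs)
    also have "\<dots> \<longleftrightarrow> (\<forall>j\<in>nbrs K k. Suc m \<le> first_visit x j)"
      using before nbrs_subset[OF assms(1) k] by blast
    also have "\<dots> \<longleftrightarrow> (\<forall>j\<in>nbrs K k - {k}. first_visit x k < first_visit x j)"
    proof -
      have at_visit: "x (first_visit x j) = j" if "j \<in> nbrs K k" for j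
        using first_visit(2)[OF visited] nbrs_subset[OF assms(1) k] that by blast
      have "Suc m \<le> first_visit x j \<longleftrightarrow> j = k \<or> Suc m < first_visit x j" if "j \<in> nbrs K k" for j
        using at_visit[OF that] \<open>x (Suc m) = k\<close> m by (cases "first_visit x j = Suc m") auto
      then show ?thesis
        unfolding m by blast
    qed
    finally show ?thesis .
  qed
  then show ?thesis
    unfolding roots_def by blast
qed

text \<open>
  Counting the sites that come no earlier gives high rank to early sites, which turns local minima
  of \<open>T\<close> into peaks.
\<close>

lemma reversed_rank_permutation:
  fixes T :: "nat \<Rightarrow> nat"
  assumes "inj_on T {1..K}"
  shows "\<exists>p. p permutes {1..K} \<and> (\<forall>j\<in>{1..K}. \<forall>k\<in>{1..K}. p j < p k \<longleftrightarrow> T k < T j)"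
proof -
  define p where "p k = (if k \<in> {1..K} then card {i \<in> {1..K}. T k \<le> T i} else k)" for k
  have less: "p j < p k" if "j \<in> {1..K}" "k \<in> {1..K}" "T k < T j" for j k
  proof -
    have "{i \<in> {1..K}. T j \<le> T i} \<subset> {i \<in> {1..K}. T k \<le> T i}"
    proof
      have "k \<in> {i \<in> {1..K}. T k \<le> T i} - {i \<in> {1..K}. T j \<le> T i}"
        using that by simp
      then show "{i \<in> {1..K}. T j \<le> T i} \<noteq> {i \<in> {1..K}. T k \<le> T i}"
        by blast
    qed (use that in auto)
    then have "card {i \<in> {1..K}. T j \<le> T i} < card {i \<in> {1..K}. T k \<le> T i}"
      by (intro psubset_card_mono) simp_all
    then show ?thesis
      using that by (simp add: p_def)
  qed
  have iff: "p j < p k \<longleftrightarrow> T k < T j" if "j \<in> {1..K}" "k \<in> {1..K}" for j k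
  proof (cases "T j" "T k" rule: linorder_cases)
    case equal
    then have "j = k"
      using inj_onD[OF assms _ that] by blast
    then show ?thesis
      by simp
  qed (use less[OF that] less[OF that(2,1)] in auto)
  have "inj_on p {1..K}"
  proof (rule inj_onI)
    fix j k
    assume jk: "j \<in> {1..K}" "k \<in> {1..K}" "p j = p k"
    then have "T j = T k"
      using iff[of j k] iff[of k j] by simp
    then show "j = k"
      using inj_onD[OF assms] jk by blast
  qed
  moreover have "p ` {1..K} \<subseteq> {1..K}"
  proof
    fix y
    assume "y \<in> p ` {1..K}"
    then obtain k where k: "k \<in> {1..K}" "y = card {i \<in> {1..K}. T k \<le> T i}"
      by (auto simp: p_def)
    have "card {k} \<le> y" "y \<le> card {1..K}"
      unfolding k(2) using k(1) by (intro card_mono; auto)+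
    then show "y \<in> {1..K}"
      by simp
  qed
  ultimately have "bij_betw p {1..K} {1..K}"
    by (simp add: bij_betw_def endo_inj_surj)
  then have "p permutes {1..K}"
    by (rule bij_imp_permutes) (simp only: p_def if_False)
  then show ?thesis
    using iff by blast
qed

lemma first_visit_relabel:
  assumes "q permutes A"
  shows "first_visit (q \<circ> x) k = first_visit x (inv q k)"
proof -
  have "q (x n) = k \<longleftrightarrow> x n = inv q k" for n
    using permutes_inverses[OF assms] by metis
  then show ?thesis
    by (simp add: first_visit_def)
qed

text \<open>
  Relabelling the sites by \<open>q\<close> replaces the rank permutation \<open>p\<close> by \<open>p \<circ> inv q\<close>, which runs through all
  permutations as \<open>q\<close> does. The sum over all relabellings is thus the same for every deposition
  sequence that visits all sites.
\<close>

lemma sum_relabelled_roots: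
  fixes f :: "nat \<Rightarrow> 'a::real_vector"
  assumes "K \<ge> 3" and visited: "\<And>k. k \<in> {1..K} \<Longrightarrow> \<exists>n\<ge>1. x n = k"
  shows "(\<Sum>q | q permutes {1..K}. f (card (roots K (q \<circ> x)))) = fact K *\<^sub>R peak_avg K f"
proof -
  have "inj_on (first_visit x) {1..K}"
  proof (rule inj_onI)
    fix j k
    assume jk: "j \<in> {1..K}" "k \<in> {1..K}" and eq: "first_visit x j = first_visit x k"
    have "x (first_visit x i) = i" if "i \<in> {1..K}" for i
      by (rule first_visit(2)[OF visited[OF that]])
    from this[OF jk(1)] this[OF jk(2)] show "j = k"
      unfolding eq by (rule trans[OF sym])
  qed
  from reversed_rank_permutation[OF this] obtain p where p: "p permutes {1..K}"
    and less: "\<forall>j\<in>{1..K}. \<forall>k\<in>{1..K}. p j < p k \<longleftrightarrow> first_visit x k < first_visit x j"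
    by blast
  have roots: "roots K (q \<circ> x) = {k \<in> {1..K}. is_peak K (p \<circ> inv q) k}" if q: "q permutes {1..K}" for q
  proof -
    have inv: "inv q k \<in> {1..K}" if "k \<in> {1..K}" for k
      using permutes_in_image[OF permutes_inv[OF q]] that by blast
    have "\<exists>n\<ge>1. (q \<circ> x) n = k" if "k \<in> {1..K}" for k
      using visited[OF inv[OF that]] permutes_inverses(1)[OF q] by force
    then have "roots K (q \<circ> x) =
        {k \<in> {1..K}. \<forall>j\<in>nbrs K k - {k}. first_visit x (inv q k) < first_visit x (inv q j)}"
      using roots_eq_first_visit_minima[OF assms(1), of "q \<circ> x"]
      by (simp only: first_visit_relabel[OF q])
    also have "\<dots> = {k \<in> {1..K}. is_peak K (p \<circ> inv q) k}"
    proof -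
      have "first_visit x (inv q k) < first_visit x (inv q j) \<longleftrightarrow> (p \<circ> inv q) j < (p \<circ> inv q) k"
        if "k \<in> {1..K}" "j \<in> nbrs K k - {k}" for j k
      proof -
        have "j \<in> {1..K}"
          using that nbrs_subset[OF assms(1)] by blast
        then show ?thesis
          using less inv[of j] inv[OF that(1)] by simp
      qed
      then show ?thesis
        unfolding is_peak_def by blast
    qed
    finally show ?thesis .
  qed
  have "(\<Sum>q | q permutes {1..K}. f (card (roots K (q \<circ> x)))) =
      (\<Sum>q | q permutes {1..K}. f (num_peaks K (p \<circ> inv q)))"
    by (rule sum.cong) (simp_all only: mem_Collect_eq roots num_peaks_def)
  also have "\<dots> = (\<Sum>q | q permutes {1..K}. f (num_peaks K (p \<circ> q)))"
    by (rule sum_permutations_inverse[symmetric])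
  also have "\<dots> = (\<Sum>q | q permutes {1..K}. f (num_peaks K q))"
    by (rule setum_permutations_compose_left[OF p, symmetric])
  finally show ?thesis
    by (simp add: peak_avg_def)
qed

section \<open>Law of the number of roots\<close>

abbreviation seq_space :: "nat \<Rightarrow> (nat \<Rightarrow> nat) measure" where
  "seq_space K \<equiv> PiM UNIV (\<lambda>_. count_space {1..K})"

text \<open>
  The heights at a given time are built from finitely many coordinates. The maximum over a
  neighbourhood is expressed as the maximum of the values attained, a random set of naturals.
\<close>

lemma measurable_height:
  "(\<lambda>x. height K x i k) \<in> measurable (seq_space K) (count_space UNIV)"
proof (induction i arbitrary: k)
  case (Suc i)
  have [measurable]: "(\<lambda>x. height K x i j) \<in> measurable (seq_space K) (count_space UNIV)" for j
    by (rule Suc.IH)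
  have [measurable]: "(\<lambda>x. x (Suc i)) \<in> measurable (seq_space K) (count_space {1..K})"
    by (rule measurable_component_singleton) simp
  have "height K x i ` nbrs K k = {h. \<exists>j\<in>nbrs K k. height K x i j = h}" for x
    by auto
  moreover have [measurable]: "Measurable.pred (seq_space K) (\<lambda>x. \<exists>j\<in>nbrs K k. height K x i j = h)" for h
    using finite_nbrs by measurable
  ultimately have "(\<lambda>x. Max (height K x i ` nbrs K k)) \<in> measurable (seq_space K) (count_space UNIV)"
    by simp
  then have [measurable]: "(\<lambda>x. Max (height K x i ` nbrs K k) + 1) \<in> measurable (seq_space K) (count_space UNIV)"
    by (rule measurable_compose) simp
  show ?case
    unfolding height.simps by measurable
qed simp

lemma measurable_card_roots:
  "(\<lambda>x. card (roots K x)) \<in> measurable (seq_space K) (count_space UNIV)"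
proof (rule measurable_card)
  fix k
  have [measurable]: "(\<lambda>x. height K x i k) \<in> measurable (seq_space K) (count_space UNIV)" for i
    by (rule measurable_height)
  show "{x \<in> space (seq_space K). k \<in> roots K x} \<in> sets (seq_space K)"
    unfolding roots_def mem_Collect_eq by measurable
qed

lemma distr_uniform_count_measure_permutes:
  assumes "q permutes A" "finite A"
  shows "distr (uniform_count_measure A) (count_space A) q = uniform_count_measure A"
proof (rule measure_eqI_finite[of _ A])
  fix a
  assume a: "a \<in> A"
  have "q \<in> measurable (uniform_count_measure A) (count_space A)"
    using permutes_in_image[OF assms(1)] by (simp add: measurable_def sets_uniform_count_measure space_uniform_count_measure Pi_def)
  then have "emeasure (distr (uniform_count_measure A) (count_space A) q) {a} =
      emeasure (uniform_count_measure A) (q -` {a} \<inter> A)"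
    using a by (simp add: emeasure_distr space_uniform_count_measure)
  also have "q -` {a} \<inter> A = {inv q a}"
    using a permutes_inverses[OF assms(1)] permutes_in_image[OF permutes_inv[OF assms(1)]] by auto
  finally show "emeasure (distr (uniform_count_measure A) (count_space A) q) {a} =
      emeasure (uniform_count_measure A) {a}"
    using a assms permutes_in_image[OF permutes_inv[OF assms(1)]] by (simp add: emeasure_uniform_count_measure)
qed (simp_all add: assms sets_uniform_count_measure)

context ballistic_deposition
begin

lemma measurable_X: "X n \<in> measurable M (count_space {1..K})"
  using indep_X by (simp add: indep_vars_def)

lemma distr_sequence:
  "distr M (seq_space K) (\<lambda>\<omega> n. X n \<omega>) = PiM UNIV (\<lambda>_. uniform_count_measure {1..K})"
  using indep_vars_iff_distr_eq_PiM[THEN iffD1, OF UNIV_not_empty measurable_X indep_X]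
  by (simp only: uniform_X restrict_UNIV)

text \<open>
  Exchangeability of the sites: the uniform distribution is invariant under permutations.
\<close>

lemma relabelled:
  assumes "q permutes {1..K}"
  shows "ballistic_deposition M K (\<lambda>n \<omega>. q (X n \<omega>))"
proof unfold_locales
  have q: "q \<in> measurable (count_space {1..K}) (count_space {1..K})"
    using permutes_in_image[OF assms] by auto
  show "indep_vars (\<lambda>_. count_space {1..K}) (\<lambda>n \<omega>. q (X n \<omega>)) UNIV"
    using indep_X q by (rule indep_vars_compose2)
  fix n
  have "distr M (count_space {1..K}) (\<lambda>\<omega>. q (X n \<omega>)) =
      distr (distr M (count_space {1..K}) (X n)) (count_space {1..K}) q"
    using distr_distr[OF q measurable_X] by (simp add: comp_def)
  also have "\<dots> = uniform_count_measure {1..K}"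
    unfolding uniform_X by (rule distr_uniform_count_measure_permutes[OF assms finite_atLeastAtMost])
  finally show "distr M (count_space {1..K}) (\<lambda>\<omega>. q (X n \<omega>)) = uniform_count_measure {1..K}" .
qed (rule K_ge_3)

lemma measurable_sequence: "(\<lambda>\<omega> n. X n \<omega>) \<in> measurable M (seq_space K)"
  using measurable_restrict[of UNIV X M "\<lambda>_. count_space {1..K}", OF measurable_X]
  by (simp only: restrict_UNIV)

lemma measurable_num_roots: "(\<lambda>\<omega>. card (roots K (\<lambda>n. X n \<omega>))) \<in> measurable M (count_space UNIV)"
  using measurable_compose[OF measurable_sequence measurable_card_roots] by simp

lemma integrable_num_roots:
  fixes f :: "nat \<Rightarrow> 'b::{banach, second_countable_topology}"
  shows "integrable M (\<lambda>\<omega>. f (card (roots K (\<lambda>n. X n \<omega>))))"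
proof (rule integrable_const_bound)
  have "roots K x \<subseteq> {1..K}" for x
    by (auto simp: roots_def)
  then have "card (roots K x) \<le> K" for x
    using card_mono[OF finite_atLeastAtMost, of "roots K x" 1 K] by simp
  then show "AE \<omega> in M. norm (f (card (roots K (\<lambda>n. X n \<omega>)))) \<le> (\<Sum>r\<le>K. norm (f r))"
    by (intro AE_I2 member_le_sum) auto
  show "(\<lambda>\<omega>. f (card (roots K (\<lambda>n. X n \<omega>)))) \<in> borel_measurable M"
    by (rule measurable_compose[OF measurable_num_roots]) simp
qed

text \<open>
  A given site is avoided during the first \<open>N\<close> depositions with probability \<open>(1 - 1 / K) ^ N\<close>.
\<close>

lemma AE_all_sites_visited: "AE \<omega> in M. \<forall>k\<in>{1..K}. \<exists>n\<ge>1. X n \<omega> = k"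
proof (rule AE_finite_allI)
  fix k
  assume k: "k \<in> {1..K}"
  define A where "A n = X n -` ({1..K} - {k}) \<inter> space M" for n
  have [measurable]: "A n \<in> events" for n
    unfolding A_def by (rule measurable_sets[OF measurable_X]) simp
  have prob_A: "prob (A n) = 1 - 1 / K" for n
  proof -
    have "prob (A n) = measure (distr M (count_space {1..K}) (X n)) ({1..K} - {k})"
      unfolding A_def by (rule measure_distr[OF measurable_X, symmetric]) simp
    also have "\<dots> = card ({1..K} - {k}) / K"
      unfolding uniform_X by (simp add: measure_uniform_count_measure)
    finally show ?thesis
      using k K_ge_3 by (simp add: of_nat_diff field_simps)
  qed
  have "prob (\<Inter>n\<in>{1..}. A n) \<le> (1 - 1 / K) ^ N" for N
  proof (cases "N = 0")
    case False
    have "prob (\<Inter>n\<in>{1..}. A n) \<le> prob (\<Inter>n\<in>{1..N}. A n)"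
      using False by (intro finite_measure_mono sets.finite_INT) auto
    also have "\<dots> = (\<Prod>n\<in>{1..N}. prob (A n))"
      unfolding A_def by (rule indep_varsD[OF indep_X]) (use False in auto)
    finally show ?thesis
      by (simp add: prob_A)
  qed simp
  moreover have "(\<lambda>N. (1 - 1 / real K) ^ N) \<longlonglongrightarrow> 0"
    using K_ge_3 by (intro LIMSEQ_realpow_zero) auto
  ultimately have "prob (\<Inter>n\<in>{1..}. A n) \<le> 0"
    by (intro LIMSEQ_le_const) auto
  then have "AE \<omega> in M. \<omega> \<notin> (\<Inter>n\<in>{1..}. A n)"
    by (intro AE_not_in) (auto simp: null_sets_def emeasure_eq_measure measure_le_0_iff)
  then show "AE \<omega> in M. \<exists>n\<ge>1. X n \<omega> = k"
    using AE_space
  proof eventually_elim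
    case (elim \<omega>)
    then obtain n where "n \<ge> 1" "\<omega> \<notin> A n"
      by auto
    moreover have "X n \<omega> \<in> {1..K}"
      using measurable_space[OF measurable_X elim(2)] by simp
    ultimately show ?case
      using elim(2) unfolding A_def by blast
  qed
qed simp

text \<open>
  Each relabelled process has the same law as the original one, so the expectation equals its average
  over all relabellings; under the expectation that average is almost surely the constant
  \<open>peak_avg K f\<close>. In this way no distribution of the rank permutation has to be computed.
\<close>

lemma expectation_card_roots:
  fixes f :: "nat \<Rightarrow> 'b::{banach, second_countable_topology}"
  shows "expectation (\<lambda>\<omega>. f (card (roots K (\<lambda>n. X n \<omega>)))) = peak_avg K f"
proof -
  let ?R = "\<lambda>q \<omega>. f (card (roots K (\<lambda>n. q (X n \<omega>))))"
  let ?P = "{q. q permutes {1..K}}"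
  have same_law: "expectation (?R q) = expectation (?R id)" and int: "integrable M (?R q)"
    if "q permutes {1..K}" for q
  proof -
    interpret q: ballistic_deposition M K "\<lambda>n \<omega>. q (X n \<omega>)"
      by (rule relabelled[OF that])
    have f: "(\<lambda>x. f (card (roots K x))) \<in> borel_measurable (seq_space K)"
      by (rule measurable_compose[OF measurable_card_roots]) simp
    show "expectation (?R q) = expectation (?R id)"
      using integral_distr[OF measurable_sequence f, unfolded distr_sequence]
        integral_distr[OF q.measurable_sequence f, unfolded q.distr_sequence] by simp
    show "integrable M (?R q)"
      by (rule q.integrable_num_roots)
  qed
  have "fact K *\<^sub>R expectation (?R id) = (\<Sum>q\<in>?P. expectation (?R q))"
    by (simp add: same_law card_permutations[OF refl] sum_constant_scaleR)
  also have "\<dots> = expectation (\<lambda>\<omega>. \<Sum>q\<in>?P. ?R q \<omega>)"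
    by (rule Bochner_Integration.integral_sum[symmetric]) (simp add: int)
  also have "\<dots> = expectation (\<lambda>\<omega>. fact K *\<^sub>R peak_avg K f)"
  proof (rule integral_cong_AE)
    show "(\<lambda>\<omega>. \<Sum>q\<in>?P. ?R q \<omega>) \<in> borel_measurable M"
      by (intro borel_measurable_sum borel_measurable_integrable int) simp
    show "AE \<omega> in M. (\<Sum>q\<in>?P. ?R q \<omega>) = fact K *\<^sub>R peak_avg K f"
      using AE_all_sites_visited
    proof eventually_elim
      case (elim \<omega>)
      then show ?case
        using sum_relabelled_roots[OF K_ge_3, of "\<lambda>n. X n \<omega>" f] by (simp add: comp_def)
    qed
  qed simp
  finally show ?thesis
    by (simp add: prob_space)
qed

lemma expectation_num_roots: "expectation (num_roots K X) = K / 3"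
  using expectation_card_roots[of real] peak_avg_mean[OF K_ge_3]
  unfolding num_roots_def[abs_def] by simp

lemma variance_num_roots: "variance (num_roots K X) = peak_var K"
  using expectation_card_roots[of "\<lambda>r. (real r - K / 3)\<^sup>2"]
  unfolding expectation_num_roots unfolding num_roots_def peak_var_def .

lemma standardized_num_roots:
  "standardized M (num_roots K X) \<omega> = (real (card (roots K (\<lambda>n. X n \<omega>))) - K / 3) / sqrt (peak_var K)"
  unfolding standardized_def variance_num_roots unfolding expectation_num_roots num_roots_def ..

lemma measurable_standardized: "standardized M (num_roots K X) \<in> borel_measurable M"
  unfolding standardized_num_roots[abs_def]
  by (rule measurable_compose[OF measurable_num_roots]) simp

lemma real_distribution_standardized:
  "real_distribution (distr M borel (standardized M (num_roots K X)))"
  using measurable_standardized by (rule real_distribution_distr)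

lemma char_standardized:
  "char (distr M borel (standardized M (num_roots K X))) t =
     peak_avg K (\<lambda>r. iexp (t * ((real r - K / 3) / sqrt (peak_var K))))"
  unfolding char_def
  by (subst integral_distr[OF measurable_standardized])
     (simp_all only: standardized_num_roots expectation_card_roots[of "\<lambda>r. iexp (t * ((real r - K / 3) / sqrt (peak_var K)))"], simp)

end

theorem theorem1:
  fixes M :: "nat \<Rightarrow> 'a measure" and X :: "nat \<Rightarrow> nat \<Rightarrow> 'a \<Rightarrow> nat"
  assumes "\<And>K. K \<ge> 3 \<Longrightarrow> ballistic_deposition (M K) K (X K)"
  shows "(\<forall>K\<ge>3. prob_space.expectation (M K) (num_roots K (X K)) = real K / 3) \<and>
    (prob_space.variance (M 3) (num_roots 3 (X 3)) = 0 \<and>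
     prob_space.variance (M 4) (num_roots 4 (X 4)) = 2 / 9 \<and>
     prob_space.variance (M 5) (num_roots 5 (X 5)) = 2 / 9 \<and>
     prob_space.variance (M 6) (num_roots 6 (X 6)) = 4 / 15 \<and>
     (\<forall>K\<ge>7. prob_space.variance (M K) (num_roots K (X K)) = 2 * real K / 45)) \<and>
    weak_conv_m
      (\<lambda>K. distr (M K) borel (standardized (M K) (num_roots K (X K))))
      std_normal_distribution"
proof (intro conjI allI impI)
  note mean = ballistic_deposition.expectation_num_roots[OF assms]
    and var = ballistic_deposition.variance_num_roots[OF assms]
  show "prob_space.expectation (M K) (num_roots K (X K)) = real K / 3" if "K \<ge> 3" for K
    by (rule mean[OF that])
  show "prob_space.variance (M 3) (num_roots 3 (X 3)) = 0"
    by (subst var) (simp_all add: peak_var_3)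
  show "prob_space.variance (M 4) (num_roots 4 (X 4)) = 2 / 9"
    by (subst var) (simp_all add: peak_var_4)
  show "prob_space.variance (M 5) (num_roots 5 (X 5)) = 2 / 9"
    by (subst var) (simp_all add: peak_var_eq)
  show "prob_space.variance (M 6) (num_roots 6 (X 6)) = 4 / 15"
    by (subst var) (simp_all add: peak_var_eq)
  show "prob_space.variance (M K) (num_roots K (X K)) = 2 * real K / 45" if "K \<ge> 7" for K
    using that by (subst var) (simp_all add: peak_var_eq)
  let ?D = "\<lambda>K. distr (M K) borel (standardized (M K) (num_roots K (X K)))"
  have "weak_conv_m (\<lambda>K. ?D (K + 3)) std_normal_distribution"
  proof (rule levy_continuity)
    show "real_distribution (?D (K + 3))" for K
      by (rule ballistic_deposition.real_distribution_standardized[OF assms]) simp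
    show "(\<lambda>K. char (?D (K + 3)) t) \<longlonglongrightarrow> char std_normal_distribution t" for t
    proof -
      have "(\<lambda>K. peak_avg (K + 3) (\<lambda>r. iexp (t * ((real r - real (K + 3) / 3) / sqrt (peak_var (K + 3)))))) \<longlonglongrightarrow>
          complex_of_real (exp (- (t\<^sup>2 / 2)))"
        by (rule LIMSEQ_ignore_initial_segment[OF peak_avg_gauss_limit])
      then show ?thesis
        using ballistic_deposition.char_standardized[OF assms]
        by (simp add: char_std_normal_distribution)
    qed
  qed (rule real_dist_normal_dist)
  then show "weak_conv_m ?D std_normal_distribution"
    unfolding weak_conv_m_def weak_conv_def by (blast intro: LIMSEQ_offset)
qed

end
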